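(* Let $n \ge 2$ and let $f(Z)$ be a homogeneous quadratic polynomial with real coefficients on symmetric $n \times n$ variables $Z = (z_{ij})$; in the linearized vector of variables $\mathbf{z} = (z_1, \ldots, z_N)$ let $f = \mathbf{z}^T A \mathbf{z}$ with $A \in \mathbb{R}^{N \times N}$ symmetric of signature $(N-1,1)$. Let $T \in GL(N,\mathbb{R})$ be a matrix with $f(\mathbf{z}) = \sum_{j=1}^{N-1} ((T\mathbf{z})_j)^2 - ((T\mathbf{z})_N)^2$, and let $F(\mathbf{z}) = \sum_{p=1}^N F_p z_p$ be the symmetric $N \times N$ linear matrix pencil with upper left block $(T\mathbf{z})_N I_{N-1}$ and with last row and last column $((T\mathbf{z})_1, \ldots, (T\mathbf{z})_{N-1}, (T\mathbf{z})_N)$. If $M(\mathbf{z}) = \sum_{p=1}^N M_p z_p$, with symmetric $l \times l$ matrices $M_p$, is a matrix pencil for the psd cone and $C = (C_{ij})_{i,j=1}^l$ is a block matrix with blocks $C_{ij}$ of size $N \times N$ satisfying $$C = (C_{ij})_{i,j=1}^l \succeq 0, \qquad \sigma F_p = \sum_{i,j=1}^l (M_p)_{ij} C_{ij} \quad \text{for all } p = 1, \ldots, N,$$ for some $\sigma \in \{-1,1\}$, then for some linear form $\ell(\mathbf{z})$ in $\mathbf{z}$, the polynomial $-\ell(\mathbf{z})^{N-2} f$ has a determinantal representation of the form $$-\ell(\mathbf{z})^{N-2} f = \det\Big( \sum_{i,j=1}^l C_{ij} z_{ij} \Big)$$ with positive semidefinite matrices $C_{ij}$. This representation provides a certificate for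 the psd-stability of $f$ in the sense of the sufficient criterion for psd-stability recalled in the context.
   Context: The linearized vector $\mathbf{z}$ lists the $N = \binom{n+1}{2}$ independent variables $z_{ij}$, $i \le j$, of the symmetric matrix $Z$. That $M(\mathbf{z})$ is a matrix pencil for the psd cone means that the cone of positive semidefinite symmetric $n\times n$ matrices, in the linearized coordinates, is $\{\mathbf{x} \in \mathbb{R}^N : M(\mathbf{x}) \succeq 0\}$; the canonical such pencil is $(z_{ij})_{i,j=1}^n$, with $l = n$. A polynomial $f$ in the entries of a symmetric $n\times n$ matrix variable $Z$ is psd-stable if $f(Z) \neq 0$ for every complex symmetric $n \times n$ matrix $Z$ whose entrywise imaginary part is positive definite. Signature $(N-1,1)$ means $N-1$ positive eigenvalues and one negative eigenvalue. $X \succeq 0$ means that the symmetric or Hermitian matrix $X$ is positive semidefinite. $(M_p)_{ij}$ is the scalar $(i,j)$ entry of $M_p$. Sufficient criterion for psd-stability: if a Hermitian block matrix $(A_{ij})_{i,j=1}^n$ with $d\times d$ blocks is positive semidefinite and $A_0$ is Hermitian of size $d\times d$, then $\det(A_0+\sum_{i,j=1}^n A_{ij}z_{ij})$ is psd-stable or identically zero.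
   Formalization: For a general pencil the entries z_ij with i or j > n are undefined, so z_ij in the determinant is read as the (i,j) entry of M(z), which is z_ij for the canonical pencil; "positive semidefinite matrices C_ij" means that the block matrix C is positive semidefinite. *)

theory Defs
  imports Complex_Main "Jordan_Normal_Form.Schur_Decomposition"
begin

definition symm_mats :: "nat \<Rightarrow> 'a mat set" where
  "symm_mats n = {X \<in> carrier_mat n n. transpose_mat X = X}"

(* For real matrices conjugation is the identity, so pos_semidef and pos_def speak about real
   symmetric matrices; over the complex numbers they speak about Hermitian ones, where 0 <= x
   (resp. 0 < x) means that x is real and nonnegative (resp. positive). *)
definition pos_semidef :: "nat \<Rightarrow> 'a :: conjugatable_ordered_field mat \<Rightarrow> bool" where
  "pos_semidef k A \<longleftrightarrow> A \<in> carrier_mat k k \<and> mat_adjoint A = A \<and>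
     (\<forall>v \<in> carrier_vec k. 0 \<le> (A *\<^sub>v v) \<bullet>c v)"

definition pos_def :: "nat \<Rightarrow> 'a :: conjugatable_ordered_field mat \<Rightarrow> bool" where
  "pos_def k A \<longleftrightarrow> A \<in> carrier_mat k k \<and> mat_adjoint A = A \<and>
     (\<forall>v \<in> carrier_vec k. v \<noteq> 0\<^sub>v k \<longrightarrow> 0 < (A *\<^sub>v v) \<bullet>c v)"

(* A function on matrices stands for a polynomial in the entries of a symmetric n x n matrix;
   only its values on symm_mats n matter. *)
definition psd_stable :: "nat \<Rightarrow> (complex mat \<Rightarrow> complex) \<Rightarrow> bool" where
  "psd_stable n f \<longleftrightarrow> (\<forall>Z \<in> symm_mats n. pos_def n (map_mat Im Z) \<longrightarrow> f Z \<noteq> 0)"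

(* The positions (i,j) with i <= j, row by row: z_11, ..., z_1n, z_22, ..., z_nn (0-based). *)
definition sym_pairs :: "nat \<Rightarrow> (nat \<times> nat) list" where
  "sym_pairs n = [(i, j). i \<leftarrow> [0..<n], j \<leftarrow> [i..<n]]"

definition lin :: "nat \<Rightarrow> 'a mat \<Rightarrow> 'a vec" where
  "lin n Z = vec_of_list (map (\<lambda>ij. Z $$ ij) (sym_pairs n))"

lemma length_sym_pairs: "length (sym_pairs n) = Suc n choose 2"
proof -
  have "length (sym_pairs n) = (\<Sum>i<n. n - i)"
    by (simp add: sym_pairs_def length_concat comp_def interv_sum_list_conv_sum_set_nat
        atLeast0LessThan)
  also have "\<dots> = (\<Sum>i<n. Suc i)"
    by (rule sum.reindex_bij_witness[of _ "\<lambda>i. n - Suc i" "\<lambda>i. n - Suc i"]) auto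
  also have "\<dots> = Suc n choose 2"
    by (induction n) (auto simp: numeral_2_eq_2)
  finally show ?thesis .
qed

lemma lin_carrier: "lin n Z \<in> carrier_vec (Suc n choose 2)"
  by (simp add: lin_def length_sym_pairs carrier_vecI)

definition quad_form :: "'a :: comm_ring_1 mat \<Rightarrow> 'a vec \<Rightarrow> 'a" where
  "quad_form A z = z \<bullet> (A *\<^sub>v z)"

(* Eigenvalues are counted with their multiplicity as roots of the characteristic polynomial. *)
definition eig_count :: "(real \<Rightarrow> bool) \<Rightarrow> real mat \<Rightarrow> nat" where
  "eig_count P A = (\<Sum>x | eigenvalue A x \<and> P x. order x (char_poly A))"

definition has_signature :: "real mat \<Rightarrow> nat \<Rightarrow> nat \<Rightarrow> bool" where
  "has_signature A p q \<longleftrightarrow> eig_count (\<lambda>x. 0 < x) A = p \<and> eig_count (\<lambda>x. x < 0) A = q"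

(* The k x k linear matrix pencil with coefficient matrices M 0, M 1, ..., evaluated at z. *)
definition pencil :: "nat \<Rightarrow> (nat \<Rightarrow> 'a :: comm_ring_1 mat) \<Rightarrow> 'a vec \<Rightarrow> 'a mat" where
  "pencil k M z = mat k k (\<lambda>(i, j). \<Sum>p<dim_vec z. M p $$ (i, j) * z $ p)"

abbreviation cmat :: "real mat \<Rightarrow> complex mat" where
  "cmat \<equiv> map_mat complex_of_real"

definition psd_cone_pencil :: "nat \<Rightarrow> nat \<Rightarrow> (nat \<Rightarrow> real mat) \<Rightarrow> bool" where
  "psd_cone_pencil n l M \<longleftrightarrow>
     (\<forall>p < Suc n choose 2. M p \<in> symm_mats l) \<and>
     lin n ` {X. pos_semidef n X} = {x \<in> carrier_vec (Suc n choose 2). pos_semidef l (pencil l M x)}"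

(* The canonical pencil (z_ij) itself. *)
definition canonical_pencil :: "nat \<Rightarrow> nat \<Rightarrow> (nat \<Rightarrow> real mat) \<Rightarrow> bool" where
  "canonical_pencil n l M \<longleftrightarrow> l = n \<and> (\<forall>X \<in> symm_mats n. pencil n M (lin n X) = X)"

(* Upper left block w_N I_{N-1}; last row and last column (w_1, ..., w_{N-1}, w_N). *)
definition arrow_mat :: "nat \<Rightarrow> 'a :: zero vec \<Rightarrow> 'a mat" where
  "arrow_mat N w = mat N N (\<lambda>(i, j).
     if i = j then w $ (N - 1)
     else if j = N - 1 then w $ i
     else if i = N - 1 then w $ j
     else 0)"

definition block_mat :: "nat \<Rightarrow> nat \<Rightarrow> (nat \<Rightarrow> nat \<Rightarrow> 'a mat) \<Rightarrow> 'a mat" where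
  "block_mat l d C = mat (l * d) (l * d) (\<lambda>(a, b). C (a div d) (b div d) $$ (a mod d, b mod d))"

(* The d x d matrix sum over i,j < l of W_ij C_ij, with scalars W_ij and d x d blocks C_ij. *)
definition block_comb :: "nat \<Rightarrow> nat \<Rightarrow> (nat \<Rightarrow> nat \<Rightarrow> 'a :: comm_ring_1 mat) \<Rightarrow> 'a mat \<Rightarrow> 'a mat" where
  "block_comb d l C W = mat d d (\<lambda>(r, s). \<Sum>i<l. \<Sum>j<l. W $$ (i, j) * C i j $$ (r, s))"

end

(* Writing w = T z, the Schur complement of the arrow matrix gives
   det F(z) = w_N^(N-2) (w_N^2 - w_1^2 - ... - w_(N-1)^2) = - w_N^(N-2) f(z), and
   sum_ij M(z)_ij C_ij = sigma F(z), so the linear form is sigma w_N.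

   For stability suppose that sigma F(x + i y) v = 0 with v nonzero and y in the interior of the
   psd cone. Since v* F(.) v is real on real arguments, v* sigma F(y) v = 0. As T is invertible there
   is a direction e with sigma F(e) = I, and y - eps e still lies in the psd cone for small eps > 0.
   There M(y - eps e) is psd, hence a sum of real rank one matrices q q^T, and each of them contributes
   a value of the Hermitian form of the psd block matrix C; so
   0 <= v* sigma F(y - eps e) v = - eps |v|^2, a contradiction. *)
theory Submission
  imports Defs
begin

section \<open>Adjoints, Hermitian forms and symmetric matrices as double sums\<close>

lemma mat_adjoint_square:
  "A \<in> carrier_mat k k \<Longrightarrow> mat_adjoint A = mat k k (\<lambda>(i, j). conjugate (A $$ (j, i)))"
  by (intro eq_matI) (auto simp: mat_adjoint_def mat_of_rows_index conjugate_vec_def)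

lemma sesquilinear_expand:
  fixes A :: "'a :: conjugatable_field mat"
  assumes "A \<in> carrier_mat k k" "v \<in> carrier_vec k"
  shows "(A *\<^sub>v v) \<bullet>c v = (\<Sum>i<k. \<Sum>j<k. A $$ (i, j) * v $ j * conjugate (v $ i))"
  using assms
  by (auto simp: scalar_prod_def sum_distrib_right atLeast0LessThan intro!: sum.cong)

lemma pos_semidef_entry_conj:
  assumes "pos_semidef k A" "a < k" "b < k"
  shows "A $$ (a, b) = conjugate (A $$ (b, a))"
proof -
  have "A = mat k k (\<lambda>(i, j). conjugate (A $$ (j, i)))"
    using assms(1) mat_adjoint_square[of A k] by (auto simp: pos_semidef_def)
  then show ?thesis
    using assms(2,3) by (metis (no_types, lifting) index_mat(1) case_prod_conv)
qed

lemma pos_semidef_sum: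
  assumes "pos_semidef k A"
  shows "0 \<le> (\<Sum>i<k. \<Sum>j<k. A $$ (i, j) * x j * conjugate (x i))"
proof -
  have "0 \<le> (A *\<^sub>v vec k x) \<bullet>c vec k x"
    using assms by (auto simp: pos_semidef_def)
  also have "\<dots> = (\<Sum>i<k. \<Sum>j<k. A $$ (i, j) * x j * conjugate (x i))"
    using assms by (subst sesquilinear_expand[of _ k]) (auto simp: pos_semidef_def)
  finally show ?thesis .
qed

lemma real_adjoint_eq_transpose:
  fixes A :: "real mat"
  assumes "A \<in> carrier_mat k k"
  shows "mat_adjoint A = transpose_mat A"
  using assms by (auto simp: mat_adjoint_square intro!: eq_matI)

lemma real_pos_semidefI:
  fixes A :: "real mat"
  assumes "A \<in> symm_mats k"
    and "\<And>x. 0 \<le> (\<Sum>i<k. \<Sum>j<k. A $$ (i, j) * x i * x j)"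
  shows "pos_semidef k A"
proof -
  have A: "A \<in> carrier_mat k k" "transpose_mat A = A"
    using assms(1) by (auto simp: symm_mats_def)
  have "0 \<le> (A *\<^sub>v v) \<bullet>c v" if "v \<in> carrier_vec k" for v
    unfolding sesquilinear_expand[OF A(1) that] using assms(2)[of "\<lambda>i. v $ i"]
    by (simp add: mult_ac)
  then show ?thesis
    using A by (simp add: pos_semidef_def real_adjoint_eq_transpose)
qed

lemma symm_mats_entry:
  assumes "A \<in> symm_mats k" "i < k" "j < k"
  shows "A $$ (i, j) = A $$ (j, i)"
proof -
  have "A \<in> carrier_mat k k" and A: "transpose_mat A = A"
    using assms(1) by (auto simp: symm_mats_def)
  then have "transpose_mat A $$ (i, j) = A $$ (j, i)"
    using assms(2,3) by (intro index_transpose_mat(1)) auto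
  then show ?thesis by (simp only: A)
qed

section \<open>Completing the square and rank one decompositions\<close>

lemma quadratic_split_last:
  fixes m :: "nat \<Rightarrow> nat \<Rightarrow> real"
  assumes "\<forall>i<Suc k. \<forall>j<Suc k. m i j = m j i"
  shows "(\<Sum>i<Suc k. \<Sum>j<Suc k. m i j * x i * x j) =
    (\<Sum>i<k. \<Sum>j<k. m i j * x i * x j) + 2 * x k * (\<Sum>i<k. m i k * x i) + m k k * (x k)\<^sup>2"
proof -
  have "(\<Sum>j<k. m k j * x k * x j) = x k * (\<Sum>i<k. m i k * x i)"
    using assms by (auto simp: sum_distrib_left mult_ac intro!: sum.cong)
  moreover have "(\<Sum>i<k. m i k * x i * x k) = x k * (\<Sum>i<k. m i k * x i)"
    by (auto simp: sum_distrib_left mult_ac intro!: sum.cong)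
  ultimately show ?thesis
    by (simp add: sum.distrib power2_eq_square)
qed

text \<open>The remaining coefficients form the Schur complement of the pivot \<open>m k k\<close>.
  The inductions in \<open>psd_sum_of_rank_one\<close> and \<open>pos_def_coercive\<close> both
  eliminate the last variable this way.\<close>

lemma quadratic_complete_square:
  fixes m :: "nat \<Rightarrow> nat \<Rightarrow> real"
  assumes "\<forall>i<Suc k. \<forall>j<Suc k. m i j = m j i" and "m k k \<noteq> 0"
  shows "(\<Sum>i<Suc k. \<Sum>j<Suc k. m i j * x i * x j) =
    (\<Sum>i<k. \<Sum>j<k. (m i j - m i k * m j k / m k k) * x i * x j)
      + m k k * (x k + (\<Sum>i<k. m i k * x i) / m k k)\<^sup>2"
proof -
  let ?b = "\<Sum>i<k. m i k * x i"
  have "(\<Sum>i<k. \<Sum>j<k. (m i j - m i k * m j k / m k k) * x i * x j)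
      = (\<Sum>i<k. \<Sum>j<k. m i j * x i * x j) - ?b * ?b / m k k"
    by (simp add: sum_product sum_divide_distrib algebra_simps flip: sum_subtractf)
  moreover have "2 * x k * ?b + m k k * (x k)\<^sup>2 = m k k * (x k + ?b / m k k)\<^sup>2 - ?b * ?b / m k k"
    using assms(2) by (simp add: power2_eq_square field_simps)
  ultimately show ?thesis
    unfolding quadratic_split_last[of k m, OF assms(1)] by linarith
qed

text \<open>A Cholesky-type induction: subtracting the rank one matrix built from the last column
  leaves a Schur complement that is positive semidefinite in one variable fewer.\<close>

lemma psd_sum_of_rank_one:
  fixes m :: "nat \<Rightarrow> nat \<Rightarrow> real"
  assumes "\<forall>i<l. \<forall>j<l. m i j = m j i"
    and "\<And>x. 0 \<le> (\<Sum>i<l. \<Sum>j<l. m i j * x i * x j)"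
  shows "\<exists>q. \<forall>i<l. \<forall>j<l. m i j = (\<Sum>k<l. q k i * q k j)"
  using assms
proof (induction l arbitrary: m)
  case 0
  then show ?case by simp
next
  case (Suc l)
  note sym = Suc.prems(1) and psd = Suc.prems(2)
  note split = quadratic_split_last[of l m, OF sym]
  define d where "d = m l l"
  have d: "0 \<le> d"
    using psd[of "\<lambda>i. if i = l then 1 else 0"] unfolding split by (simp add: d_def)
  have col: "m i l = 0" if "d = 0" "i < l" for i
  proof (rule ccontr)
    assume nz: "m i l \<noteq> 0"
    \<comment> \<open>As \<open>m l l = 0\<close>, the form at the i-th unit vector plus
      \<open>t\<close> times the last one is \<open>m i i + 2 * t * m i l\<close>, affine in
      \<open>t\<close>; this choice makes it -1.\<close>
    define t where "t = - (m i i + 1) / (2 * m i l)"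
    define x where "x = (\<lambda>j. if j = l then t else if j = i then 1 else 0 :: real)"
    have "(\<Sum>a<l. \<Sum>b<l. m a b * x a * x b)
        = (\<Sum>a<l. \<Sum>b<l. if b = i then if a = i then m a b else 0 else 0)"
      by (intro sum.cong) (auto simp: x_def)
    also have "\<dots> = m i i"
      using that by simp
    finally have "(\<Sum>a<l. \<Sum>b<l. m a b * x a * x b) = m i i" .
    moreover have "(\<Sum>a<l. m a l * x a) = (\<Sum>a<l. if a = i then m a l else 0)"
      by (intro sum.cong) (auto simp: x_def)
    ultimately have "0 \<le> m i i + 2 * t * m i l"
      using psd[of x] that unfolding split by (simp add: x_def d_def)
    then show False
      using nz by (simp add: t_def field_simps)
  qed
  \<comment> \<open>If \<open>d = 0\<close>, the last column vanishes, and since \<open>x / 0 = 0\<close> the Schur complement \<open>m'\<close> is just \<open>m\<close>.\<close>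
  define m' where "m' = (\<lambda>i j. m i j - m i l * m j l / d)"
  have "0 \<le> (\<Sum>i<l. \<Sum>j<l. m' i j * x i * x j)" for x
  proof (cases "d = 0")
    case True
    then show ?thesis
      using psd[of "x(l := 0)"] unfolding split by (simp add: m'_def cong: sum.cong_simp)
  next
    case False
    \<comment> \<open>The last coordinate is chosen so that the completed square vanishes.\<close>
    show ?thesis
      using psd[of "x(l := - (\<Sum>i<l. m i l * x i) / d)"] False
      unfolding quadratic_complete_square[of l m, OF sym False[unfolded d_def]]
      by (simp add: m'_def d_def cong: sum.cong_simp)
  qed
  then obtain q where q: "\<forall>i<l. \<forall>j<l. m' i j = (\<Sum>k<l. q k i * q k j)"
    using Suc.IH[of m'] sym by (fastforce simp: m'_def)
  \<comment> \<open>The new vector \<open>p l\<close> is the last column divided by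
    \<open>sqrt d\<close>; the old ones are extended by 0. For \<open>d = 0\<close>, division by
    zero makes \<open>p l\<close> the zero vector.\<close>
  define p where "p = (\<lambda>k i. if k = l then m i l / sqrt d else if i = l then 0 else q k i)"
  have "m i j = (\<Sum>k<Suc l. p k i * p k j)" if ij: "i < Suc l" "j < Suc l" for i j
  proof -
    have last: "p l i * p l j = m i l * m j l / d"
      using d by (simp add: p_def)
    have rest: "(\<Sum>k<l. p k i * p k j) = (if i < l \<and> j < l then m' i j else 0)"
      using q ij by (auto simp: p_def intro!: sum.neutral)
    show ?thesis
    proof (cases "i < l \<and> j < l")
      case True
      then show ?thesis by (simp add: last rest m'_def)
    next
      case False
      then consider "i = l" | "j = l" using False ij by (auto simp: less_Suc_eq)
      \<comment> \<open>In the last row and column only \<open>p l\<close> contributes. For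
        \<open>d = 0\<close> both sides vanish by \<open>col\<close>; otherwise the pivot among the
        two factors cancels against \<open>d\<close>.\<close>
      then have "m i j = m i l * m j l / d"
      proof cases
        case 1
        have "m l j = m j l" using sym ij(2) by blast
        then show ?thesis
          using 1 ij(2) col[of j] by (cases "d = 0"; cases "j = l") (auto simp: d_def)
      next
        case 2
        then show ?thesis
          using ij(1) col[of i] by (cases "d = 0"; cases "i = l") (auto simp: d_def)
      qed
      then show ?thesis
        using False by (auto simp: last rest)
    qed
  qed
  then show ?case by blast
qed

section \<open>Quantitative positive definiteness and perturbation\<close>

text \<open>Each product \<open>x i * x j\<close> is bounded by the squared norm through 2ab \<le>
  a^2 + b^2; this crude constant is enough for the perturbation argument.\<close>

lemma quadratic_bound:
  fixes e :: "nat \<Rightarrow> nat \<Rightarrow> real"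
  shows "\<bar>\<Sum>i<k. \<Sum>j<k. e i j * x i * x j\<bar> \<le> (\<Sum>i<k. \<Sum>j<k. \<bar>e i j\<bar>) * (\<Sum>i<k. (x i)\<^sup>2)"
proof -
  let ?s = "\<Sum>i<k. (x i)\<^sup>2"
  have "\<bar>x i * x j\<bar> \<le> ?s" if "i < k" "j < k" for i j
  proof -
    have "(x i)\<^sup>2 \<le> ?s" "(x j)\<^sup>2 \<le> ?s"
      using that by (auto intro!: member_le_sum)
    moreover have "2 * \<bar>x i * x j\<bar> \<le> (x i)\<^sup>2 + (x j)\<^sup>2"
      using sum_squares_bound[of "\<bar>x i\<bar>" "\<bar>x j\<bar>"] by (simp add: abs_mult)
    ultimately show ?thesis by linarith
  qed
  then have "\<bar>e i j * x i * x j\<bar> \<le> \<bar>e i j\<bar> * ?s" if "i < k" "j < k" for i j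
    using that by (simp add: abs_mult mult.assoc mult_left_mono)
  then have "(\<Sum>i<k. \<Sum>j<k. \<bar>e i j * x i * x j\<bar>) \<le> (\<Sum>i<k. \<Sum>j<k. \<bar>e i j\<bar> * ?s)"
    by (intro sum_mono) auto
  moreover have "\<bar>\<Sum>i<k. \<Sum>j<k. e i j * x i * x j\<bar> \<le> (\<Sum>i<k. \<Sum>j<k. \<bar>e i j * x i * x j\<bar>)"
    by (rule order_trans[OF sum_abs sum_mono[OF sum_abs]])
  ultimately show ?thesis
    by (simp add: sum_distrib_right)
qed

text \<open>Induction with completed squares gives an explicit constant, in place of compactness of
  the unit sphere.\<close>

lemma pos_def_coercive:
  fixes m :: "nat \<Rightarrow> nat \<Rightarrow> real"
  assumes "\<forall>i<k. \<forall>j<k. m i j = m j i"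
    and "\<And>x. \<exists>i<k. x i \<noteq> 0 \<Longrightarrow> 0 < (\<Sum>i<k. \<Sum>j<k. m i j * x i * x j)"
  shows "\<exists>\<delta>>0. \<forall>x. \<delta> * (\<Sum>i<k. (x i)\<^sup>2) \<le> (\<Sum>i<k. \<Sum>j<k. m i j * x i * x j)"
  using assms
proof (induction k arbitrary: m)
  case 0
  then show ?case by (auto intro: exI[of _ 1])
next
  case (Suc l)
  note sym = Suc.prems(1) and pd = Suc.prems(2)
  define d where "d = m l l"
  have d: "0 < d"
    using pd[of "\<lambda>i. if i = l then 1 else 0"]
    unfolding quadratic_split_last[of l m, OF sym] by (simp add: d_def)
  define m' where "m' = (\<lambda>i j. m i j - m i l * m j l / d)"
  define b where "b x = (\<Sum>i<l. m i l * x i)" for x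
  have square: "(\<Sum>i<Suc l. \<Sum>j<Suc l. m i j * x i * x j)
      = (\<Sum>i<l. \<Sum>j<l. m' i j * x i * x j) + d * (x l + b x / d)\<^sup>2" for x
    using quadratic_complete_square[of l m x, OF sym] d by (simp only: m'_def b_def d_def)
  have "0 < (\<Sum>i<l. \<Sum>j<l. m' i j * x i * x j)" if "\<exists>i<l. x i \<noteq> 0" for x
  proof -
    \<comment> \<open>The last coordinate cancels the square; \<open>b\<close> reads only
      coordinates below \<open>l\<close>, so the update does not change it.\<close>
    let ?x = "x(l := - b x / d)"
    have "\<exists>i<Suc l. ?x i \<noteq> 0"
      using that by (metis fun_upd_apply less_SucI nat_neq_iff)
    then have "0 < (\<Sum>i<l. \<Sum>j<l. m' i j * ?x i * ?x j) + d * (?x l + b ?x / d)\<^sup>2"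
      using pd[of ?x] unfolding square by blast
    moreover have "b ?x = b x" "(\<Sum>i<l. \<Sum>j<l. m' i j * ?x i * ?x j) = (\<Sum>i<l. \<Sum>j<l. m' i j * x i * x j)"
      by (auto simp: b_def intro!: sum.cong)
    ultimately show ?thesis by simp
  qed
  then obtain \<delta> where \<delta>: "\<delta> > 0"
    "\<And>x. \<delta> * (\<Sum>i<l. (x i)\<^sup>2) \<le> (\<Sum>i<l. \<Sum>j<l. m' i j * x i * x j)"
    using Suc.IH[of m'] sym by (fastforce simp: m'_def)
  define K where "K = (\<Sum>i<l. \<Sum>j<l. \<bar>m i l * m j l\<bar>)"
  have K: "0 \<le> K" unfolding K_def by (intro sum_nonneg) auto
  have b: "(b x)\<^sup>2 \<le> K * (\<Sum>i<l. (x i)\<^sup>2)" for x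
  proof -
    have "(b x)\<^sup>2 = (\<Sum>i<l. \<Sum>j<l. (m i l * m j l) * x i * x j)"
      by (simp add: b_def power2_eq_square sum_product mult_ac)
    then show ?thesis
      using quadratic_bound[of "\<lambda>i j. m i l * m j l" x l] by (simp add: K_def)
  qed
  \<comment> \<open>From \<open>x l = u - b x / d\<close>, with \<open>u\<close> the base of the
    completed square, \<open>(x l)\<^sup>2\<close> is at most
    \<open>2 * u\<^sup>2 + 2 * (b x / d)\<^sup>2\<close>. Together with \<open>b\<close> this makes
    \<open>B\<close> the coefficient of the squared norm of the first \<open>l\<close>
    coordinates.\<close>
  define B where "B = 1 + 2 * K / d\<^sup>2"
  have B: "0 \<le> B" using K by (simp add: B_def)
  \<comment> \<open>\<open>P\<close> covers both parts of the completed form: the first via the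
    induction constant \<open>\<delta>\<close>, the square via the pivot \<open>d\<close>. Its
    reciprocal is the new coercivity constant.\<close>
  define P where "P = B / \<delta> + 2 / d"
  have P: "0 < P"
    unfolding P_def using B d \<delta>(1) by (intro add_nonneg_pos) auto
  have "(\<Sum>i<Suc l. (x i)\<^sup>2) \<le> P * (\<Sum>i<Suc l. \<Sum>j<Suc l. m i j * x i * x j)" for x
  proof -
    define s where "s = (\<Sum>i<l. (x i)\<^sup>2)"
    define q where "q = (\<Sum>i<l. \<Sum>j<l. m' i j * x i * x j)"
    define u where "u = x l + b x / d"
    have s: "s \<le> q / \<delta>" "0 \<le> s"
      using \<delta>(2)[of x] \<delta>(1) by (auto simp: s_def q_def field_simps intro: sum_nonneg)
    have q: "0 \<le> q" using s \<delta>(1) by (metis order_trans zero_le_divide_iff not_le)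
    have "(x l)\<^sup>2 \<le> 2 * u\<^sup>2 + 2 * (b x / d)\<^sup>2"
      using sum_squares_bound[of u "- b x / d"] by (simp add: u_def power2_eq_square algebra_simps)
    also have "(b x / d)\<^sup>2 \<le> K * s / d\<^sup>2"
      using b[of x] by (simp add: power_divide divide_right_mono s_def)
    finally have "s + (x l)\<^sup>2 \<le> B * s + 2 * u\<^sup>2"
      by (simp add: B_def algebra_simps)
    also have "B * s \<le> B * (q / \<delta>)"
      by (intro mult_left_mono s(1) B)
    also have "\<dots> \<le> P * q"
      using q d by (simp add: P_def algebra_simps)
    also have "2 * u\<^sup>2 \<le> P * (d * u\<^sup>2)"
      using d B \<delta>(1) by (simp add: P_def algebra_simps)
    finally show ?thesis
      unfolding square by (simp add: s_def q_def u_def algebra_simps)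
  qed
  then have "1 / P * (\<Sum>i<Suc l. (x i)\<^sup>2) \<le> (\<Sum>i<Suc l. \<Sum>j<Suc l. m i j * x i * x j)" for x
    using P by (simp only: pos_divide_le_eq mult.commute[of P] times_divide_eq_left mult_1)
  then show ?case
    using P by (intro exI[of _ "1 / P"]) auto
qed

text \<open>The coercivity margin of \<open>Y\<close> absorbs a small multiple of any symmetric
  \<open>E\<close>; positive definite matrices are thus interior to the psd cone.\<close>

lemma pos_def_perturb:
  assumes "pos_def k Y" and "E \<in> symm_mats k"
  shows "\<exists>\<epsilon>>0. pos_semidef k (Y - \<epsilon> \<cdot>\<^sub>m E :: real mat)"
proof -
  have Y: "Y \<in> carrier_mat k k" "transpose_mat Y = Y"
    and pd: "\<And>v. v \<in> carrier_vec k \<Longrightarrow> v \<noteq> 0\<^sub>v k \<Longrightarrow> 0 < (Y *\<^sub>v v) \<bullet>c v"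
    using assms(1) by (auto simp: pos_def_def real_adjoint_eq_transpose)
  then have sY: "Y \<in> symm_mats k" by (simp add: symm_mats_def)
  have entry: "\<forall>i<k. \<forall>j<k. Y $$ (i, j) = Y $$ (j, i)"
    using symm_mats_entry[OF sY] by blast
  have "0 < (\<Sum>i<k. \<Sum>j<k. Y $$ (i, j) * x i * x j)" if "\<exists>i<k. x i \<noteq> 0" for x
  proof -
    have "vec k x \<noteq> 0\<^sub>v k" using that by (metis index_vec index_zero_vec(1))
    then have "0 < (Y *\<^sub>v vec k x) \<bullet>c vec k x" by (intro pd) auto
    then show ?thesis
      unfolding sesquilinear_expand[OF Y(1) vec_carrier] by (simp add: mult_ac)
  qed
  then obtain \<delta> where \<delta>: "\<delta> > 0"
    "\<And>x. \<delta> * (\<Sum>i<k. (x i)\<^sup>2) \<le> (\<Sum>i<k. \<Sum>j<k. Y $$ (i, j) * x i * x j)"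
    using pos_def_coercive[of k "\<lambda>i j. Y $$ (i, j)", OF entry] by blast
  \<comment> \<open>The summand 1 keeps \<open>K\<close> positive even for \<open>E = 0\<close>, so
    that \<open>\<delta> / K\<close> is a positive step length.\<close>
  define K where "K = (\<Sum>i<k. \<Sum>j<k. \<bar>E $$ (i, j)\<bar>) + 1"
  have K: "0 < K" unfolding K_def by (intro add_nonneg_pos sum_nonneg) auto
  define \<epsilon> where "\<epsilon> = \<delta> / K"
  have \<epsilon>: "0 < \<epsilon>" using K \<delta> by (simp add: \<epsilon>_def)
  have E: "E \<in> carrier_mat k k" "transpose_mat E = E"
    using assms(2) by (auto simp: symm_mats_def)
  have "pos_semidef k (Y - \<epsilon> \<cdot>\<^sub>m E)"
  proof (rule real_pos_semidefI)
    show "Y - \<epsilon> \<cdot>\<^sub>m E \<in> symm_mats k"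
      using Y E symm_mats_entry[OF sY] symm_mats_entry[OF assms(2)]
      by (auto simp: symm_mats_def intro!: eq_matI)
    fix x :: "nat \<Rightarrow> real"
    let ?s = "\<Sum>i<k. (x i)\<^sup>2" and ?e = "\<Sum>i<k. \<Sum>j<k. E $$ (i, j) * x i * x j"
    have "0 \<le> ?s" by (intro sum_nonneg) auto
    then have "?e \<le> K * ?s"
      using quadratic_bound[of "\<lambda>i j. E $$ (i, j)" x k] by (simp add: K_def algebra_simps)
    then have "\<epsilon> * ?e \<le> \<delta> * ?s"
      using K mult_left_mono[of ?e "K * ?s" \<epsilon>] \<epsilon> by (simp add: \<epsilon>_def)
    also have "\<dots> \<le> (\<Sum>i<k. \<Sum>j<k. Y $$ (i, j) * x i * x j)"
      by (rule \<delta>(2))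
    finally have "0 \<le> (\<Sum>i<k. \<Sum>j<k. Y $$ (i, j) * x i * x j) - \<epsilon> * ?e"
      by simp
    also have "\<dots> = (\<Sum>i<k. \<Sum>j<k. (Y - \<epsilon> \<cdot>\<^sub>m E) $$ (i, j) * x i * x j)"
      using Y E by (simp add: sum_distrib_left algebra_simps flip: sum_subtractf)
    finally show "0 \<le> (\<Sum>i<k. \<Sum>j<k. (Y - \<epsilon> \<cdot>\<^sub>m E) $$ (i, j) * x i * x j)" .
  qed
  then show ?thesis using \<epsilon> by blast
qed

section \<open>Positive semidefinite block matrices\<close>

text \<open>Splits an index into block number and offset, matching \<open>div\<close> and
  \<open>mod\<close> in \<open>block_mat\<close>.\<close>

lemma sum_lessThan_mult:
  fixes f :: "nat \<Rightarrow> 'a :: comm_monoid_add"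
  shows "(\<Sum>a<l * d. f a) = (\<Sum>i<l. \<Sum>r<d. f (i * d + r))"
proof -
  have "sum f {i * d..<i * d + d} = (\<Sum>r<d. f (i * d + r))" for i
    by (rule sum.reindex_bij_witness[of _ "\<lambda>r. i * d + r" "\<lambda>a. a - i * d"]) auto
  then show ?thesis
    by (simp add: sum.nat_group[symmetric])
qed

text \<open>Once \<open>X\<close> is a sum of rank one matrices given by vectors \<open>q k\<close>,
  the k-th contribution is the Hermitian form of the block matrix at the Kronecker product of
  \<open>q k\<close> and \<open>v\<close>.\<close>

lemma block_comb_psd:
  fixes C :: "nat \<Rightarrow> nat \<Rightarrow> complex mat"
  assumes C: "pos_semidef (l * d) (block_mat l d C)" and X: "pos_semidef l X"
  shows "0 \<le> (\<Sum>r<d. \<Sum>s<d. block_comb d l C (cmat X) $$ (r, s) * v s * cnj (v r))"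
proof -
  have Xc: "X \<in> carrier_mat l l" using X by (simp add: pos_semidef_def)
  have sym: "\<forall>i<l. \<forall>j<l. X $$ (i, j) = X $$ (j, i)"
    using pos_semidef_entry_conj[OF X] by simp
  have "0 \<le> (\<Sum>i<l. \<Sum>j<l. X $$ (i, j) * x i * x j)" for x
    using pos_semidef_sum[OF X, of x] by (simp add: mult_ac)
  then obtain q where q: "\<forall>i<l. \<forall>j<l. X $$ (i, j) = (\<Sum>k<l. q k i * q k j)"
    using psd_sum_of_rank_one[of l "\<lambda>i j. X $$ (i, j)", OF sym] by blast
  \<comment> \<open>All sums below share this summand, so what remains is to reorder them.\<close>
  define g where "g k i r j s =
    complex_of_real (q k i * q k j) * C i j $$ (r, s) * v s * cnj (v r)" for k i r j s
  have block: "block_mat l d C $$ (i * d + r, j * d + s) = C i j $$ (r, s)"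
    if "i < l" "j < l" "r < d" "s < d" for i j r s
  proof -
    have "i * d + r < l * d" "j * d + s < l * d"
      using that mult_le_mono1[of "Suc i" l d] mult_le_mono1[of "Suc j" l d] by auto
    then show ?thesis using that by (simp add: block_mat_def)
  qed
  have entry: "block_comb d l C (cmat X) $$ (r, s) * v s * cnj (v r)
      = (\<Sum>k<l. \<Sum>i<l. \<Sum>j<l. g k i r j s)" if "r < d" "s < d" for r s
  proof -
    have "block_comb d l C (cmat X) $$ (r, s) * v s * cnj (v r)
        = (\<Sum>i<l. \<Sum>j<l. \<Sum>k<l. g k i r j s)"
      using that q Xc by (simp add: block_comb_def g_def sum_distrib_right cong: sum.cong_simp)
    also have "\<dots> = (\<Sum>i<l. \<Sum>k<l. \<Sum>j<l. g k i r j s)"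
      by (rule sum.cong[OF refl], rule sum.swap)
    also have "\<dots> = (\<Sum>k<l. \<Sum>i<l. \<Sum>j<l. g k i r j s)"
      by (rule sum.swap)
    finally show ?thesis .
  qed
  have nonneg: "0 \<le> (\<Sum>r<d. \<Sum>s<d. \<Sum>i<l. \<Sum>j<l. g k i r j s)" for k
  proof -
    let ?u = "\<lambda>a. complex_of_real (q k (a div d)) * v (a mod d)"
    have "0 \<le> (\<Sum>a<l * d. \<Sum>b<l * d. block_mat l d C $$ (a, b) * ?u b * conjugate (?u a))"
      by (rule pos_semidef_sum[OF C])
    also have "\<dots> = (\<Sum>i<l. \<Sum>r<d. \<Sum>j<l. \<Sum>s<d. g k i r j s)"
      unfolding sum_lessThan_mult by (intro sum.cong refl) (auto simp: block g_def mult_ac)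
    also have "\<dots> = (\<Sum>r<d. \<Sum>i<l. \<Sum>j<l. \<Sum>s<d. g k i r j s)"
      by (rule sum.swap)
    also have "\<dots> = (\<Sum>r<d. \<Sum>i<l. \<Sum>s<d. \<Sum>j<l. g k i r j s)"
      by (rule sum.cong[OF refl], rule sum.cong[OF refl], rule sum.swap)
    also have "\<dots> = (\<Sum>r<d. \<Sum>s<d. \<Sum>i<l. \<Sum>j<l. g k i r j s)"
      by (rule sum.cong[OF refl], rule sum.swap)
    finally show ?thesis .
  qed
  have "0 \<le> (\<Sum>k<l. \<Sum>r<d. \<Sum>s<d. \<Sum>i<l. \<Sum>j<l. g k i r j s)"
    by (rule sum_nonneg[OF nonneg])
  also have "\<dots> = (\<Sum>r<d. \<Sum>k<l. \<Sum>s<d. \<Sum>i<l. \<Sum>j<l. g k i r j s)"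
    by (rule sum.swap)
  also have "\<dots> = (\<Sum>r<d. \<Sum>s<d. \<Sum>k<l. \<Sum>i<l. \<Sum>j<l. g k i r j s)"
    by (rule sum.cong[OF refl], rule sum.swap)
  also have "\<dots> = (\<Sum>r<d. \<Sum>s<d. block_comb d l C (cmat X) $$ (r, s) * v s * cnj (v r))"
    by (intro sum.cong refl) (simp add: entry)
  finally show ?thesis .
qed

section \<open>The determinant of the arrow matrix\<close>

text \<open>If the diagonal entry is nonzero, the matrix can be made triangular. If it is zero, the
  right-hand side vanishes because \<open>3 \<le> d\<close> makes the exponent positive, and
  singularity is shown by a kernel vector.\<close>

lemma det_arrow_mat:
  fixes w :: "'a :: idom vec"
  assumes "3 \<le> d" and "w \<in> carrier_vec d"
  shows "det (arrow_mat d w) =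
    (w $ (d - 1)) ^ (d - 2) * ((w $ (d - 1))\<^sup>2 - (\<Sum>j<d - 1. (w $ j)\<^sup>2))"
proof -
  define t where "t = w $ (d - 1)"
  obtain m where m: "d = Suc (Suc m)" "0 < m"
    using assms(1) by (metis Suc_le_D Suc_le_mono eval_nat_numeral(3) numeral_2_eq_2 zero_less_Suc)
  have carrier: "arrow_mat d w \<in> carrier_mat d d" by (simp add: arrow_mat_def)
  show ?thesis
  proof (cases "t = 0")
    case True
    \<comment> \<open>The first two columns are multiples of the last unit vector, so they are dependent.\<close>
    define u where "u = vec d (\<lambda>j. if j = 0 then if w $ 0 = 0 \<and> w $ 1 = 0 then 1 else w $ 1
      else if j = 1 then - w $ 0 else 0)"
    have "arrow_mat d w *\<^sub>v u = 0\<^sub>v d"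
    proof (rule eq_vecI)
      fix i assume "i < dim_vec (0\<^sub>v d :: 'a vec)"
      then have i: "i < d" by simp
      then have "(arrow_mat d w *\<^sub>v u) $ i = (\<Sum>j<d. arrow_mat d w $$ (i, j) * u $ j)"
        using carrier by (simp add: scalar_prod_def u_def atLeast0LessThan)
      also have "\<dots> = arrow_mat d w $$ (i, 0) * u $ 0 + arrow_mat d w $$ (i, 1) * u $ 1"
        unfolding m(1) sum.lessThan_Suc_shift by (simp add: u_def m(1))
      also have "\<dots> = 0"
        using i m True by (auto simp: arrow_mat_def u_def t_def)
      finally show "(arrow_mat d w *\<^sub>v u) $ i = 0\<^sub>v d $ i" using i by simp
    qed (simp add: arrow_mat_def)
    \<comment> \<open>When \<open>w $ 0\<close> and \<open>w $ 1\<close> both vanish, the default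
      entry 1 keeps \<open>u\<close> nonzero.\<close>
    moreover have "u $ 0 \<noteq> 0 \<or> u $ 1 \<noteq> 0"
      by (auto simp: u_def m(1))
    then have "u \<noteq> 0\<^sub>v d" using m(1) by auto
    moreover have "u \<in> carrier_vec d" by (simp add: u_def)
    ultimately have "det (arrow_mat d w) = 0"
      using det_0_iff_vec_prod_zero[OF carrier] by blast
    then show ?thesis using True m by (simp add: t_def)
  next
    case False
    \<comment> \<open>Column operations clear the last column above the diagonal; scaling it by \<open>t\<close> avoids divisions.\<close>
    define U where "U = mat d d (\<lambda>(i, j). if j = d - 1 then if i = d - 1 then t else - w $ i
      else if i = j then 1 else 0)"
    have U: "U \<in> carrier_mat d d" by (simp add: U_def)
    have "det U = prod_list (diag_mat U)"
      by (rule det_upper_triangular[OF _ U]) (auto simp: U_def)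
    also have "\<dots> = (\<Prod>i<d. U $$ (i, i))"
      using U by (simp add: prod_list_diag_prod atLeast0LessThan)
    also have "\<dots> = t"
      unfolding m(1) prod.lessThan_Suc by (simp add: U_def m(1))
    finally have det_U: "det U = t" .
    define P where "P = arrow_mat d w * U"
    have P: "P \<in> carrier_mat d d" using U carrier by (simp add: P_def)
    have entry: "P $$ (i, j) = (\<Sum>k<Suc m. arrow_mat d w $$ (i, k) * U $$ (k, j))
        + arrow_mat d w $$ (i, Suc m) * U $$ (Suc m, j)" if "i < d" "j < d" for i j
      using that U carrier by (simp add: P_def scalar_prod_def atLeast0LessThan m(1))
    have arrow: "arrow_mat d w $$ (i, j) = (if i = j then t else if j = Suc m then w $ i
      else if i = Suc m then w $ j else 0)" if "i < d" "j < d" for i j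
      using that by (simp add: arrow_mat_def t_def m(1))
    have left: "P $$ (i, j) = arrow_mat d w $$ (i, j)" if "i < d" "j < Suc m" for i j
    proof -
      have "(\<Sum>k<Suc m. arrow_mat d w $$ (i, k) * U $$ (k, j))
          = (\<Sum>k<Suc m. if k = j then arrow_mat d w $$ (i, k) else 0)"
        using that by (intro sum.cong) (auto simp: U_def m(1))
      then show ?thesis
        using that by (simp add: entry m(1) U_def)
    qed
    have upper: "P $$ (i, Suc m) = 0" if "i < Suc m" for i
    proof -
      have "(\<Sum>k<Suc m. arrow_mat d w $$ (i, k) * U $$ (k, Suc m))
          = (\<Sum>k<Suc m. if k = i then - t * w $ i else 0)"
        using that by (intro sum.cong) (auto simp: U_def m(1) arrow[unfolded m(1)])
      then show ?thesis
        using that by (simp add: entry m(1) U_def arrow[unfolded m(1)] mult.commute del: sum.lessThan_Suc)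
    qed
    have corner: "P $$ (Suc m, Suc m) = t\<^sup>2 - (\<Sum>j<Suc m. (w $ j)\<^sup>2)"
    proof -
      have "(\<Sum>k<Suc m. arrow_mat d w $$ (Suc m, k) * U $$ (k, Suc m)) = (\<Sum>k<Suc m. - (w $ k)\<^sup>2)"
        by (intro sum.cong) (auto simp: U_def m(1) arrow[unfolded m(1)] power2_eq_square)
      then show ?thesis
        by (simp add: entry m(1) U_def arrow[unfolded m(1)] power2_eq_square sum_negf del: sum.lessThan_Suc)
    qed
    have "det (arrow_mat d w) * t = det P"
      using det_mult[OF carrier U] by (simp add: det_U P_def)
    also have "\<dots> = prod_list (diag_mat P)"
    proof (rule det_lower_triangular[OF _ P])
      fix i j assume "i < j" "j < d"
      then show "P $$ (i, j) = 0"
        by (cases "j = Suc m") (auto simp: upper left arrow[unfolded m(1)] m(1))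
    qed
    also have "\<dots> = (\<Prod>i<Suc m. P $$ (i, i)) * P $$ (Suc m, Suc m)"
      using P by (simp add: prod_list_diag_prod atLeast0LessThan m(1))
    also have "(\<Prod>i<Suc m. P $$ (i, i)) = (\<Prod>i<Suc m. t)"
      by (intro prod.cong) (auto simp: left arrow[unfolded m(1)] m(1))
    \<comment> \<open>The first \<open>Suc m\<close> diagonal entries give \<open>t ^ Suc m\<close>;
      one factor \<open>t\<close> cancels against \<open>det U\<close>, leaving the exponent
      \<open>m = d - 2\<close>.\<close>
    finally have "det (arrow_mat d w) * t = (t ^ m * (t\<^sup>2 - (\<Sum>j<Suc m. (w $ j)\<^sup>2))) * t"
      by (simp add: corner mult_ac del: sum.lessThan_Suc)
    then show ?thesis
      using False by (simp add: m(1) t_def)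
  qed
qed

section \<open>Linearization of symmetric matrices\<close>

lemma lin_index: "p < Suc n choose 2 \<Longrightarrow> lin n Z $ p = Z $$ (sym_pairs n ! p)"
  by (simp add: lin_def vec_of_list_index length_sym_pairs)

lemma sym_pairs_nth:
  assumes "p < Suc n choose 2"
  obtains i j where "sym_pairs n ! p = (i, j)" "i \<le> j" "j < n"
proof -
  have "sym_pairs n ! p \<in> set (sym_pairs n)"
    using assms by (simp add: length_sym_pairs)
  then show thesis
    using that by (auto simp: sym_pairs_def)
qed

lemma distinct_sym_pairs: "distinct (sym_pairs n)"
proof -
  \<comment> \<open>\<open>distinct_concat\<close> requires the rows to differ as lists; each is
    nonempty and reveals its index in its first entry.\<close>
  have "inj_on (\<lambda>i. map (Pair i) [i..<n]) {0..<n}"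
    by (rule inj_onI) (metis atLeastLessThan_iff fst_conv list.map_sel(1) upt_rec list.discI list.sel(1) list.map_disc_iff)
  then show ?thesis
    unfolding sym_pairs_def
    by (auto intro!: distinct_concat simp: distinct_map inj_on_def comp_def)
qed

text \<open>Turns the direction vector of the stability argument into a symmetric matrix to which
  \<open>pos_def_perturb\<close> applies.\<close>

lemma lin_surj:
  assumes e: "e \<in> carrier_vec (Suc n choose 2)"
  obtains E :: "'a :: comm_monoid_add mat" where "E \<in> symm_mats n" "lin n E = e"
proof
  let ?N = "Suc n choose 2"
  \<comment> \<open>The sum is a table lookup, since at most one \<open>p\<close> matches a
    position; sorting the indices with \<open>min\<close> and \<open>max\<close> makes
    \<open>E\<close> symmetric.\<close>
  define E where "E = mat n n (\<lambda>(i, j).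
    \<Sum>p<?N. if p < ?N \<and> sym_pairs n ! p = (min i j, max i j) then e $ p else 0)"
  show "E \<in> symm_mats n"
    by (auto simp: symm_mats_def E_def min.commute max.commute intro!: eq_matI)
  show "lin n E = e"
  proof (rule eq_vecI)
    fix q assume "q < dim_vec e"
    then have q: "q < ?N" using e by simp
    then obtain i j where ij: "sym_pairs n ! q = (i, j)" "i \<le> j" "j < n"
      by (rule sym_pairs_nth)
    have "lin n E $ q = (\<Sum>p<?N. if sym_pairs n ! p = sym_pairs n ! q then e $ p else 0)"
      using ij q by (simp add: lin_index E_def cong: sum.cong_simp)
    also have "\<dots> = (\<Sum>p<?N. if p = q then e $ p else 0)"
      using q distinct_sym_pairs[of n]
      by (intro sum.cong) (auto simp: nth_eq_iff_index_eq length_sym_pairs)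
    also have "\<dots> = e $ q" using q by simp
    finally show "lin n E $ q = e $ q" .
  qed (use e lin_carrier[of n E] in auto)
qed

section \<open>Passing from real to complex arguments\<close>

text \<open>The imaginary part is the polar form of \<open>Q\<close>, so both parts are expressed by
  values of \<open>Q\<close> at real points, and identities between real quadratic forms carry over
  to complex vectors.\<close>

lemma quadratic_complexify:
  fixes a :: "nat \<Rightarrow> nat \<Rightarrow> real" and z :: "nat \<Rightarrow> complex" and d :: nat
  defines "Q \<equiv> (\<lambda>x. \<Sum>p<d. \<Sum>q<d. a p q * x p * x q)"
  shows "(\<Sum>p<d. \<Sum>q<d. complex_of_real (a p q) * z p * z q) =
    Complex (Q (\<lambda>p. Re (z p)) - Q (\<lambda>p. Im (z p)))
      (Q (\<lambda>p. Re (z p) + Im (z p)) - Q (\<lambda>p. Re (z p)) - Q (\<lambda>p. Im (z p)))"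
  by (simp add: Q_def complex_eq_iff algebra_simps sum.distrib sum_subtractf)

lemma mult_mat_vec_index:
  "B \<in> carrier_mat m d \<Longrightarrow> z \<in> carrier_vec d \<Longrightarrow> i < m \<Longrightarrow>
    (B *\<^sub>v z) $ i = (\<Sum>p<d. B $$ (i, p) * z $ p)"
  by (simp add: scalar_prod_def atLeast0LessThan)

lemma quad_form_sum:
  assumes "B \<in> carrier_mat d d" "z \<in> carrier_vec d"
  shows "quad_form B z = (\<Sum>p<d. \<Sum>q<d. B $$ (p, q) * z $ p * z $ q)"
proof -
  have "quad_form B z = (\<Sum>p<d. z $ p * (B *\<^sub>v z) $ p)"
    using assms by (simp add: quad_form_def scalar_prod_def[of z] atLeast0LessThan)
  also have "\<dots> = (\<Sum>p<d. \<Sum>q<d. B $$ (p, q) * z $ p * z $ q)"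
    using assms by (intro sum.cong) (auto simp: mult_mat_vec_index sum_distrib_left mult_ac simp del: index_mult_mat_vec)
  finally show ?thesis .
qed

text \<open>The hypothesis \<open>diag\<close> concerns real vectors only. The real matrix
  \<open>T\<close> acts separately on real and imaginary parts, so
  \<open>quadratic_complexify\<close> transfers it.\<close>

lemma diagonal_form_complexify:
  assumes A: "A \<in> carrier_mat d d" and T: "T \<in> carrier_mat d d" and d: "0 < d"
    and diag: "\<forall>x \<in> carrier_vec d.
      quad_form A x = (\<Sum>j<d - 1. ((T *\<^sub>v x) $ j)\<^sup>2) - ((T *\<^sub>v x) $ (d - 1))\<^sup>2"
    and z: "z \<in> carrier_vec d"
  shows "quad_form (cmat A) z =
    (\<Sum>j<d - 1. ((cmat T *\<^sub>v z) $ j)\<^sup>2) - ((cmat T *\<^sub>v z) $ (d - 1))\<^sup>2"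
proof -
  define q where "q x = (\<Sum>p<d. \<Sum>q<d. A $$ (p, q) * x p * x q)" for x
  define t where "t j x = (\<Sum>p<d. T $$ (j, p) * x p)" for j x
  have real: "q x = (\<Sum>j<d - 1. (t j x)\<^sup>2) - (t (d - 1) x)\<^sup>2" for x
    using bspec[OF diag vec_carrier[of d x]] d
    by (simp add: quad_form_sum[OF A] mult_mat_vec_index[OF T] q_def t_def
        cong: sum.cong_simp del: index_mult_mat_vec)
  define x where "x p = Re (z $ p)" for p
  define y where "y p = Im (z $ p)" for p
  have add: "t j (\<lambda>p. x p + y p) = t j x + t j y" for j
    by (simp add: t_def distrib_left sum.distrib)
  have w: "(cmat T *\<^sub>v z) $ j = Complex (t j x) (t j y)" if "j < d" for j
    using that T z by (simp add: mult_mat_vec_index[of _ d d] complex_eq_iff t_def x_def y_def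
        del: index_mult_mat_vec)
  have "quad_form (cmat A) z
      = Complex (q x - q y) (q (\<lambda>p. x p + y p) - q x - q y)"
    using A z quadratic_complexify[of "\<lambda>p q. A $$ (p, q)" "\<lambda>p. z $ p" d]
    by (simp add: quad_form_sum[of _ d] q_def x_def y_def)
  also have "\<dots> = (\<Sum>j<d - 1. ((cmat T *\<^sub>v z) $ j)\<^sup>2) - ((cmat T *\<^sub>v z) $ (d - 1))\<^sup>2"
    using d by (simp add: w real add complex_eq_iff power2_eq_square algebra_simps
        sum.distrib sum_subtractf cong: sum.cong_simp del: index_mult_mat_vec)
  finally show ?thesis .
qed

section \<open>Coefficients of linear pencils\<close>

lemma arrow_mat_index:
  "r < d \<Longrightarrow> s < d \<Longrightarrow> arrow_mat d w $$ (r, s) =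
    (if r = s then w $ (d - 1) else if s = d - 1 then w $ r else if r = d - 1 then w $ s else 0)"
  by (simp add: arrow_mat_def)

lemma pencil_index:
  "z \<in> carrier_vec d \<Longrightarrow> r < k \<Longrightarrow> s < k \<Longrightarrow> pencil k M z $$ (r, s) = (\<Sum>p<d. M p $$ (r, s) * z $ p)"
  by (auto simp: pencil_def)

text \<open>Evaluation at the p-th unit vector isolates \<open>F p\<close> as the arrow matrix of
  the p-th column of \<open>T\<close>.\<close>

lemma arrow_pencil_coeff:
  assumes T: "T \<in> carrier_mat d d"
    and F: "\<forall>z \<in> carrier_vec d. pencil d F z = arrow_mat d (T *\<^sub>v z)"
    and p: "p < d" and rs: "r < d" "s < d"
  shows "F p $$ (r, s) = (if r = s then T $$ (d - 1, p) else if s = d - 1 then T $$ (r, p)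
    else if r = d - 1 then T $$ (s, p) else 0 :: 'a :: comm_ring_1)"
proof -
  have "F p $$ (r, s) = (\<Sum>q<d. if q = p then F q $$ (r, s) else 0)"
    using p by simp
  also have "\<dots> = (\<Sum>q<d. F q $$ (r, s) * unit_vec d p $ q)"
    by (intro sum.cong) (auto simp: unit_vec_def)
  also have "\<dots> = arrow_mat d (T *\<^sub>v unit_vec d p) $$ (r, s)"
    using rs bspec[OF F unit_vec_carrier[of d p]]
    by (simp add: pencil_index[OF unit_vec_carrier] flip: bspec[OF F unit_vec_carrier])
  also have "\<dots> = (if r = s then T $$ (d - 1, p) else if s = d - 1 then T $$ (r, p)
    else if r = d - 1 then T $$ (s, p) else 0)"
    using T p rs by (simp add: arrow_mat_index)
  finally show ?thesis .
qed

lemma block_comb_pencil: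
  assumes "z \<in> carrier_vec d" "r < m" "s < m"
  shows "block_comb m l C (pencil l M z) $$ (r, s) = (\<Sum>p<d. z $ p * block_comb m l C (M p) $$ (r, s))"
proof -
  have "block_comb m l C (pencil l M z) $$ (r, s)
      = (\<Sum>i<l. \<Sum>j<l. \<Sum>p<d. z $ p * (M p $$ (i, j) * C i j $$ (r, s)))"
    using assms by (simp add: block_comb_def pencil_index[OF assms(1)] sum_distrib_left
        sum_distrib_right mult_ac)
  also have "\<dots> = (\<Sum>i<l. \<Sum>p<d. \<Sum>j<l. z $ p * (M p $$ (i, j) * C i j $$ (r, s)))"
    by (rule sum.cong[OF refl], rule sum.swap)
  also have "\<dots> = (\<Sum>p<d. \<Sum>i<l. \<Sum>j<l. z $ p * (M p $$ (i, j) * C i j $$ (r, s)))"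
    by (rule sum.swap)
  also have "\<dots> = (\<Sum>p<d. z $ p * block_comb m l C (M p) $$ (r, s))"
    using assms by (simp add: block_comb_def sum_distrib_left)
  finally show ?thesis .
qed

section \<open>The determinantal representation and the stability certificate\<close>

theorem corollary4p9:
  fixes n N l :: nat
    and f :: "complex mat \<Rightarrow> complex"
    and A T :: "real mat"
    and F M :: "nat \<Rightarrow> real mat"
    and C :: "nat \<Rightarrow> nat \<Rightarrow> complex mat"
    and \<sigma> :: real
  assumes n: "n \<ge> 2"
    and N: "N = Suc n choose 2"
    and A: "A \<in> symm_mats N" "has_signature A (N - 1) 1"
    and f: "\<forall>Z \<in> symm_mats n. f Z = quad_form (cmat A) (lin n Z)"
    and T: "T \<in> carrier_mat N N" "invertible_mat T"
    and T_diag: "\<forall>z \<in> carrier_vec N.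
          quad_form A z = (\<Sum>j<N - 1. ((T *\<^sub>v z) $ j)\<^sup>2) - ((T *\<^sub>v z) $ (N - 1))\<^sup>2"
    and F_carrier: "\<forall>p<N. F p \<in> carrier_mat N N"
    and F: "\<forall>z \<in> carrier_vec N. pencil N F z = arrow_mat N (T *\<^sub>v z)"
    and M: "psd_cone_pencil n l M"
    and C_carrier: "\<forall>i<l. \<forall>j<l. C i j \<in> carrier_mat N N"
    and C_psd: "pos_semidef (l * N) (block_mat l N C)"
    and \<sigma>: "\<sigma> \<in> {-1, 1}"
    and F_eq: "\<forall>p<N. cmat (\<sigma> \<cdot>\<^sub>m F p) = block_comb N l C (cmat (M p))"
  shows "\<exists>c \<in> carrier_vec N.
     let L = (\<lambda>Z. map_vec complex_of_real c \<bullet> lin n Z);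
         D = (\<lambda>Z. det (block_comb N l C (pencil l (\<lambda>p. cmat (M p)) (lin n Z))))
     in (\<forall>Z \<in> symm_mats n. - ((L Z) ^ (N - 2) * f Z) = D Z) \<and>
        (canonical_pencil n l M \<longrightarrow>
          (\<forall>Z \<in> symm_mats n. - ((L Z) ^ (N - 2) * f Z) = det (block_comb N l C Z))) \<and>
        pos_semidef (l * N) (block_mat l N C) \<and>
        psd_stable n D \<and>
        psd_stable n f"
proof -
  have N3: "3 \<le> N"
  proof -
    have "Suc 2 choose 2 \<le> Suc n choose 2"
      using n by (intro binomial_right_mono) auto
    then show ?thesis by (simp add: N numeral_3_eq_3 numeral_2_eq_2)
  qed
  have lin_N [simp]: "lin n Z \<in> carrier_vec N" for Z :: "'b mat"
    unfolding N by (rule lin_carrier)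
  let ?M = "\<lambda>p. cmat (M p)"
  have M_entry: "?M p $$ (i, j) = of_real (M p $$ (i, j))" if "p < N" "i < l" "j < l" for p i j
    using M that by (auto simp: psd_cone_pencil_def symm_mats_def simp flip: N)
  \<comment> \<open>By \<open>F_eq\<close> this is \<open>\<sigma>\<close> times the pencil of
    \<open>F\<close> at a complex point. The hypothesis \<open>F\<close> speaks of real points,
    hence the passage through the coefficients \<open>\<phi>\<close>.\<close>
  define W where "W z = block_comb N l C (pencil l ?M z)" for z
  have W_carrier: "W z \<in> carrier_mat N N" for z
    by (simp add: W_def block_comb_def)
  define \<phi> where "\<phi> p r s = \<sigma> * F p $$ (r, s)" for p r s
  have W_sum: "W z $$ (r, s) = (\<Sum>p<N. z $ p * of_real (\<phi> p r s))"
    if "z \<in> carrier_vec N" "r < N" "s < N" for z r s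
  proof -
    have "block_comb N l C (?M p) $$ (r, s) = of_real (\<phi> p r s)" if "p < N" for p
    proof -
      have "F p \<in> carrier_mat N N" using F_carrier that by blast
      then have "cmat (\<sigma> \<cdot>\<^sub>m F p) $$ (r, s) = of_real (\<phi> p r s)"
        using \<open>r < N\<close> \<open>s < N\<close> by (simp add: \<phi>_def)
      then show ?thesis using F_eq that by simp
    qed
    then show ?thesis
      unfolding W_def block_comb_pencil[OF that] by (intro sum.cong) auto
  qed
  note coeff = arrow_pencil_coeff[OF T(1) F]
  have W_arrow: "W z = complex_of_real \<sigma> \<cdot>\<^sub>m arrow_mat N (cmat T *\<^sub>v z)"
    if z: "z \<in> carrier_vec N" for z
  proof (rule eq_matI)
    fix r s
    assume "r < dim_row (complex_of_real \<sigma> \<cdot>\<^sub>m arrow_mat N (cmat T *\<^sub>v z))"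
      "s < dim_col (complex_of_real \<sigma> \<cdot>\<^sub>m arrow_mat N (cmat T *\<^sub>v z))"
    then have rs: "r < N" "s < N" by (auto simp: arrow_mat_def)
    have w: "(cmat T *\<^sub>v z) $ i = (\<Sum>p<N. of_real (T $$ (i, p)) * z $ p)" if "i < N" for i
      using that T(1) z by (simp add: mult_mat_vec_index[of _ N N] del: index_mult_mat_vec)
    have "W z $$ (r, s) = of_real \<sigma> * (\<Sum>p<N. of_real (F p $$ (r, s)) * z $ p)"
      by (simp add: W_sum[OF z rs] \<phi>_def sum_distrib_left mult_ac)
    also have "(\<Sum>p<N. of_real (F p $$ (r, s)) * z $ p) = arrow_mat N (cmat T *\<^sub>v z) $$ (r, s)"
      using rs N3 by (simp add: coeff arrow_mat_index w del: index_mult_mat_vec)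
    finally show "W z $$ (r, s) = (complex_of_real \<sigma> \<cdot>\<^sub>m arrow_mat N (cmat T *\<^sub>v z)) $$ (r, s)"
      using rs by (simp add: arrow_mat_def)
  qed (auto simp: W_def block_comb_def arrow_mat_def)
  define c where "c = \<sigma> \<cdot>\<^sub>v row T (N - 1)"
  have c: "c \<in> carrier_vec N" using T(1) by (intro carrier_vecI) (simp add: c_def)
  let ?L = "\<lambda>Z. map_vec complex_of_real c \<bullet> lin n Z"
  have \<sigma>2: "\<sigma>\<^sup>2 = 1" using \<sigma> by auto
  have det_W: "- ((?L Z) ^ (N - 2) * f Z) = det (W (lin n Z))" if Z: "Z \<in> symm_mats n" for Z
  proof -
    let ?w = "cmat T *\<^sub>v lin n Z"
    define t where "t = ?w $ (N - 1)"
    define S where "S = (\<Sum>j<N - 1. (?w $ j)\<^sup>2)"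
    have w: "?w \<in> carrier_vec N" using T(1) by simp
    have "?L Z = (\<Sum>p<N. of_real (\<sigma> * T $$ (N - 1, p)) * lin n Z $ p)"
      unfolding scalar_prod_def carrier_vecD[OF lin_N[of Z]]
      using T(1) N3 by (simp add: c_def atLeast0LessThan cong: sum.cong_simp)
    also have "\<dots> = of_real \<sigma> * t"
      using T(1) N3 by (simp add: t_def mult_mat_vec_index[of _ N N] sum_distrib_left mult_ac
          del: index_mult_mat_vec)
    finally have L: "?L Z = of_real \<sigma> * t" .
    have "f Z = S - t\<^sup>2"
      using A(1) N3 f Z diagonal_form_complexify[OF _ T(1) _ T_diag lin_N[of Z]]
      by (simp add: symm_mats_def S_def t_def)
    moreover have "det (W (lin n Z)) = of_real \<sigma> ^ N * (t ^ (N - 2) * (t\<^sup>2 - S))"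
      using det_arrow_mat[OF N3 w] by (simp add: W_arrow S_def t_def arrow_mat_def)
    \<comment> \<open>The sign enters the determinant \<open>N\<close> times but the power of the
      linear form only \<open>N - 2\<close> times; \<open>\<sigma>\<^sup>2 = 1\<close> reconciles
      the two.\<close>
    moreover have "complex_of_real \<sigma> ^ N = of_real \<sigma> ^ (N - 2)"
    proof -
      obtain k where "N = 3 + k"
        using N3 le_Suc_ex by blast
      then have "complex_of_real \<sigma> ^ N = of_real \<sigma> ^ (N - 2) * of_real (\<sigma>\<^sup>2)"
        by (simp add: power_add power3_eq_cube power2_eq_square)
      then show ?thesis by (simp add: \<sigma>2)
    qed
    ultimately show ?thesis
      by (simp add: L power_mult_distrib left_diff_distrib right_diff_distrib mult_ac)
  qed
  have canonical: "pencil l ?M (lin n Z) = Z" if "canonical_pencil n l M" "Z \<in> symm_mats n" for Z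
  proof (rule eq_matI)
    have ln: "l = n" and can: "\<And>X. X \<in> symm_mats n \<Longrightarrow> pencil n M (lin n X) = X"
      using that(1) by (auto simp: canonical_pencil_def)
    have Zc: "Z \<in> carrier_mat n n" using that(2) by (simp add: symm_mats_def)
    show "dim_row (pencil l ?M (lin n Z)) = dim_row Z" "dim_col (pencil l ?M (lin n Z)) = dim_col Z"
      using Zc by (auto simp: pencil_def ln)
    fix i j assume "i < dim_row Z" "j < dim_col Z"
    then have ij: "i < n" "j < n" using Zc by auto
    \<comment> \<open>\<open>canonical_pencil\<close> is a statement about real matrices, so it is
      applied to the real and the imaginary part of \<open>Z\<close> separately.\<close>
    have part: "(\<Sum>p<N. M p $$ (i, j) * h (lin n Z $ p)) = h (Z $$ (i, j))"
      if "h = Re \<or> h = Im" for h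
    proof -
      have "map_mat h Z \<in> symm_mats n"
        using Zc symm_mats_entry[OF \<open>Z \<in> symm_mats n\<close>]
        by (auto simp: symm_mats_def intro!: eq_matI)
      then have "pencil n M (lin n (map_mat h Z)) $$ (i, j) = h (Z $$ (i, j))"
        using can Zc ij by simp
      moreover have "lin n (map_mat h Z) $ p = h (lin n Z $ p)" if p: "p < N" for p
      proof -
        obtain a b where "sym_pairs n ! p = (a, b)" "a \<le> b" "b < n"
          using sym_pairs_nth p unfolding N by blast
        then show ?thesis using p Zc by (simp add: N lin_index)
      qed
      ultimately show ?thesis
        using ij by (simp add: pencil_index[OF lin_N] cong: sum.cong_simp)
    qed
    show "pencil l ?M (lin n Z) $$ (i, j) = Z $$ (i, j)"
      using ij part[of Re] part[of Im] by (simp add: pencil_index[OF lin_N] ln complex_eq_iff M_entry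
          cong: sum.cong_simp)
  qed
  have stable: "det (W (lin n Z)) \<noteq> 0" if Z: "Z \<in> symm_mats n" "pos_def n (map_mat Im Z)" for Z
  proof
    assume "det (W (lin n Z)) = 0"
    then obtain v where v: "v \<in> carrier_vec N" "v \<noteq> 0\<^sub>v N" "W (lin n Z) *\<^sub>v v = 0\<^sub>v N"
      using det_0_iff_vec_prod_zero[OF W_carrier] by blast
    \<comment> \<open>\<open>h p\<close> is the Hermitian form of \<open>\<sigma>\<close> times
      \<open>F p\<close> at \<open>v\<close>; the form of \<open>W z\<close> at \<open>v\<close> is
      then linear in \<open>z\<close> with these coefficients.\<close>
    define h where "h p = (\<Sum>r<N. \<Sum>s<N. of_real (\<phi> p r s) * v $ s * cnj (v $ r))" for p
    have W_form: "(\<Sum>r<N. \<Sum>s<N. W z $$ (r, s) * v $ s * cnj (v $ r)) = (\<Sum>p<N. z $ p * h p)"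
      if "z \<in> carrier_vec N" for z
    proof -
      have "(\<Sum>r<N. \<Sum>s<N. W z $$ (r, s) * v $ s * cnj (v $ r))
          = (\<Sum>r<N. \<Sum>s<N. \<Sum>p<N. z $ p * (of_real (\<phi> p r s) * v $ s * cnj (v $ r)))"
        using that by (simp add: W_sum sum_distrib_left sum_distrib_right mult_ac)
      also have "\<dots> = (\<Sum>r<N. \<Sum>p<N. \<Sum>s<N. z $ p * (of_real (\<phi> p r s) * v $ s * cnj (v $ r)))"
        by (rule sum.cong[OF refl], rule sum.swap)
      also have "\<dots> = (\<Sum>p<N. \<Sum>r<N. \<Sum>s<N. z $ p * (of_real (\<phi> p r s) * v $ s * cnj (v $ r)))"
        by (rule sum.swap)
      finally show ?thesis by (simp add: h_def sum_distrib_left)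
    qed
    \<comment> \<open>By \<open>coeff\<close> the real matrix \<open>F p\<close> is symmetric, so
      conjugation merely exchanges \<open>r\<close> and \<open>s\<close>.\<close>
    have h_real: "h p = of_real (Re (h p))" if "p < N" for p
    proof -
      have "cnj (h p) = (\<Sum>r<N. \<Sum>s<N. of_real (\<phi> p s r) * v $ r * cnj (v $ s))"
        using that by (auto simp: h_def \<phi>_def coeff mult_ac intro!: sum.cong)
      also have "\<dots> = h p" unfolding h_def by (rule sum.swap)
      finally show ?thesis
        by (metis Reals_cnj_iff of_real_Re)
    qed
    have "(\<Sum>p<N. lin n Z $ p * h p) = 0"
    proof -
      have "(\<Sum>p<N. lin n Z $ p * h p) = (W (lin n Z) *\<^sub>v v) \<bullet>c v"
        using W_form[OF lin_N[of Z]] sesquilinear_expand[OF W_carrier v(1)] by simp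
      then show ?thesis using v(1,3) by simp
    qed
    \<comment> \<open>Since the \<open>h p\<close> are real, the imaginary part of the vanishing sum
      involves only \<open>Im Z\<close>.\<close>
    then have "0 = Im (\<Sum>p<N. lin n Z $ p * of_real (Re (h p)))"
      using h_real by (simp cong: sum.cong_simp)
    also have "\<dots> = (\<Sum>p<N. Im (lin n Z $ p) * Re (h p))"
      by simp
    finally have kernel: "(\<Sum>p<N. Im (lin n Z $ p) * Re (h p)) = 0" ..
    obtain B where B: "T * B = 1\<^sub>m N" "B \<in> carrier_mat N N"
    proof -
      \<comment> \<open>\<open>invertible_mat\<close> leaves the size of \<open>B\<close> open; it
        is read off from the two products with \<open>T\<close>.\<close>
      obtain B where B: "inverts_mat T B" "inverts_mat B T"
        using T(2) by (auto simp: invertible_mat_def)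
      then have "T * B = 1\<^sub>m N" "B * T = 1\<^sub>m (dim_row B)"
        using T(1) by (auto simp: inverts_mat_def)
      moreover have "dim_row B = N"
        by (metis B(2) T(1) carrier_matD(2) index_mult_mat(3) index_one_mat(3) inverts_mat_def)
      moreover have "dim_col B = N"
        by (metis B(1) T(1) carrier_matD(1) index_mult_mat(3) index_one_mat(3) inverts_mat_def)
      ultimately show thesis using that by auto
    qed
    \<comment> \<open>The direction in which the pencil is the identity matrix.\<close>
    define e where "e = \<sigma> \<cdot>\<^sub>v (B *\<^sub>v unit_vec N (N - 1))"
    have e: "e \<in> carrier_vec N" using B(2) by (simp add: e_def)
    have Te: "T *\<^sub>v e = \<sigma> \<cdot>\<^sub>v unit_vec N (N - 1)"
    proof -
      have "T *\<^sub>v e = \<sigma> \<cdot>\<^sub>v (T *\<^sub>v (B *\<^sub>v unit_vec N (N - 1)))"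
        unfolding e_def using T(1) B(2) by (intro mult_mat_vec) auto
      also have "T *\<^sub>v (B *\<^sub>v unit_vec N (N - 1)) = (T * B) *\<^sub>v unit_vec N (N - 1)"
        using T(1) B(2) by (intro assoc_mult_mat_vec[symmetric]) auto
      finally show ?thesis by (simp add: B(1))
    qed
    have We: "(\<Sum>p<N. e $ p * \<phi> p r s) = (if r = s then 1 else 0)" if "r < N" "s < N" for r s
    proof -
      have "(\<Sum>p<N. e $ p * \<phi> p r s) = \<sigma> * (\<Sum>p<N. F p $$ (r, s) * e $ p)"
        by (simp add: \<phi>_def sum_distrib_left mult_ac)
      also have "(\<Sum>p<N. F p $$ (r, s) * e $ p) = arrow_mat N (T *\<^sub>v e) $$ (r, s)"
        using that bspec[OF F e] pencil_index[OF e, of r N s F] by simp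
      \<comment> \<open>The arrow matrix of \<open>T *\<^sub>v e\<close> is \<open>\<sigma>\<close>
        times the identity, and the outer factor turns the diagonal into
        \<open>\<sigma>\<^sup>2\<close>.\<close>
      also have "\<sigma> * \<dots> = (if r = s then \<sigma>\<^sup>2 else 0)"
        using that N3 by (auto simp: Te arrow_mat_index power2_eq_square)
      finally show ?thesis using \<sigma>2 by simp
    qed
    define nv where "nv = (\<Sum>r<N. (cmod (v $ r))\<^sup>2)"
    have nv: "0 < nv"
    proof -
      obtain r where "r < N" "v $ r \<noteq> 0"
        using v(1,2) by (metis eq_vecI carrier_vecD index_zero_vec)
      then show ?thesis
        unfolding nv_def by (intro sum_pos2[of _ r]) auto
    qed
    have he: "(\<Sum>p<N. e $ p * Re (h p)) = nv"
    proof -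
      let ?e = "map_vec complex_of_real e"
      have ec: "?e \<in> carrier_vec N" using e by simp
      have W_id: "W ?e $$ (r, s) = (if r = s then 1 else 0)" if "r < N" "s < N" for r s
      proof -
        have "W ?e $$ (r, s) = of_real (\<Sum>p<N. e $ p * \<phi> p r s)"
          using e that by (simp add: W_sum[OF ec])
        then show ?thesis using We[OF that] by simp
      qed
      have "(\<Sum>p<N. ?e $ p * h p) = (\<Sum>r<N. \<Sum>s<N. if r = s then v $ s * cnj (v $ r) else 0)"
        unfolding W_form[OF ec, symmetric] by (intro sum.cong) (auto simp: W_id)
      also have "\<dots> = of_real nv"
        by (simp add: nv_def complex_norm_square flip: of_real_power)
      finally have "Re (\<Sum>p<N. ?e $ p * h p) = nv" by simp
      then show ?thesis using e by simp
    qed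
    obtain E where E: "E \<in> symm_mats n" "lin n E = e"
      using lin_surj[of e n] e N by blast
    let ?Y = "map_mat Im Z"
    \<comment> \<open>\<open>Im Z\<close> is interior to the psd cone, so a short step against the
      direction \<open>E\<close> stays inside it.\<close>
    obtain \<epsilon> where \<epsilon>: "\<epsilon> > 0" "pos_semidef n (?Y - \<epsilon> \<cdot>\<^sub>m E)"
      using pos_def_perturb[OF Z(2) E(1)] by blast
    define y where "y = lin n (?Y - \<epsilon> \<cdot>\<^sub>m E)"
    have yc: "y \<in> carrier_vec N" by (simp add: y_def)
    have y: "y $ p = Im (lin n Z $ p) - \<epsilon> * e $ p" if p: "p < N" for p
    proof -
      obtain a b where "sym_pairs n ! p = (a, b)" "a \<le> b" "b < n"
        using sym_pairs_nth p unfolding N by blast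
      then show ?thesis
        using p Z(1) E(1) unfolding y_def E(2)[symmetric] by (auto simp: N lin_index symm_mats_def)
    qed
    \<comment> \<open>Here the cone hypothesis on \<open>M\<close> is used, from a psd matrix to a
      psd value of the pencil.\<close>
    have "y \<in> {x \<in> carrier_vec (Suc n choose 2). pos_semidef l (pencil l M x)}"
      using M \<epsilon>(2) unfolding psd_cone_pencil_def y_def by blast
    then have My: "pos_semidef l (pencil l M y)" by simp
    let ?y = "map_vec complex_of_real y"
    have "cmat (pencil l M y) = pencil l ?M ?y"
      using yc by (auto simp: pencil_def M_entry intro!: eq_matI sum.cong)
    then have "0 \<le> (\<Sum>r<N. \<Sum>s<N. W ?y $$ (r, s) * v $ s * cnj (v $ r))"
      using block_comb_psd[OF C_psd My, of "\<lambda>r. v $ r"] by (simp add: W_def)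
    also have "\<dots> = (\<Sum>p<N. ?y $ p * h p)"
      using yc by (intro W_form) simp
    finally have "0 \<le> Re (\<Sum>p<N. ?y $ p * h p)"
      by (simp add: less_eq_complex_def)
    also have "\<dots> = (\<Sum>p<N. y $ p * Re (h p))"
      using yc by simp
    \<comment> \<open>The part from \<open>Im Z\<close> vanishes by \<open>kernel\<close>; only the
      negative contribution of the step along \<open>e\<close> survives.\<close>
    also have "\<dots> = (\<Sum>p<N. Im (lin n Z $ p) * Re (h p)) - \<epsilon> * (\<Sum>p<N. e $ p * Re (h p))"
      by (simp add: y sum_distrib_left left_diff_distrib sum_subtractf mult.assoc)
    also have "\<dots> = - (\<epsilon> * nv)"
      by (simp add: kernel he)
    finally show False
      using \<epsilon>(1) nv by (simp add: mult_le_0_iff)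
  qed
  show ?thesis
    unfolding Let_def
  proof (intro bexI[OF _ c] conjI impI ballI C_psd)
    fix Z :: "complex mat" assume Z: "Z \<in> symm_mats n"
    show "- ((?L Z) ^ (N - 2) * f Z) = det (block_comb N l C (pencil l ?M (lin n Z)))"
      using det_W[OF Z] by (simp add: W_def)
    show "- ((?L Z) ^ (N - 2) * f Z) = det (block_comb N l C Z)" if "canonical_pencil n l M"
      using det_W[OF Z] canonical[OF that Z] by (simp add: W_def)
  next
    show "psd_stable n (\<lambda>Z. det (block_comb N l C (pencil l ?M (lin n Z))))"
      using stable by (simp add: psd_stable_def W_def)
    \<comment> \<open>By \<open>det_W\<close> a zero of \<open>f\<close> is a zero of the
      determinant, which \<open>stable\<close> excludes.\<close>
    show "psd_stable n f"
      using stable det_W by (force simp: psd_stable_def)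
  qed
qed

end
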